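(* The expected cumulative regret of OMM on any matroid bandit $(M,P)$ with $L$ items and rank $K$ over $n$ episodes satisfies $$R(n)\le 8\sqrt{KLn\log n}+\frac{4}{3}\pi^2KL.$$
   Context: A matroid $M=(E,\mathcal I)$ has ground set $E=\{1,\dots,L\}$ and rank $K$ (all bases, i.e. maximal independent sets, have cardinality $K$). For $X\in\mathcal I$ let $E(X)=\{e\in E\setminus X: X\cup\{e\}\in\mathcal I\}$. For $A\subseteq E$ and $w\in\mathbb R^L$ let $f(A,w)=\sum_{e\in A}w(e)$. A matroid bandit is a pair $(M,P)$ where $M$ is a known matroid and $P$ is an unknown probability distribution on $[0,1]^L$ (no independence between coordinates is assumed); $\bar w=\mathbb E_{w\sim P}[w]$. Weight vectors $w_0,w_1,w_2,\dots$ are drawn i.i.d. from $P$. $A^*$ is a fixed basis maximizing $f(A,\bar w)$ over $A\in\mathcal I$. Algorithm OMM (Optimistic Matroid Maximization): Initialization: observe $w_0$, set $\hat w_{e,1}=w_0(e)$ and $T_e(0)=1$ for all $e\in E$. For episodes $t=1,\dots,n$: compute $U_t(e)=\hat w_{e,T_e(t-1)}+c_{t-1,T_e(t-1)}$ for all $e$, where $c_{t,s}=\sqrt{2\log(t)/s}$ (with $c_{0,s}=0$); order the items as $e^t_1,\dots,e^t_L$ with $U_t(e^t_1)\ge\dots\ge U_t(e^t_L)$; start with $A^t=\emptyset$ and for $i=1,\dots,L$ add $e^t_i$ to $A^t$ if $e^t_i\in E(A^t)$. Then observe $w_t(e)$ for all $e\in A^t$ (semi-bandit feedback); set $T_e(t)=T_e(t-1)+\mathbf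 1[e\in A^t]$, and for $e\in A^t$ update $\hat w_{e,T_e(t)}=\big(T_e(t-1)\hat w_{e,T_e(t-1)}+w_t(e)\big)/T_e(t)$. The expected cumulative regret over $n$ episodes is $R(n)=\mathbb E\big[\sum_{t=1}^n\big(f(A^*,w_t)-f(A^t,w_t)\big)\big]$. *)

theory Defs
  imports "HOL-Probability.Probability"
begin

definition matroid :: "nat \<Rightarrow> nat set set \<Rightarrow> bool" where
  "matroid L \<I> \<longleftrightarrow>
     (\<forall>X\<in>\<I>. X \<subseteq> {1..L}) \<and> {} \<in> \<I> \<and>
     (\<forall>X Y. X \<in> \<I> \<and> Y \<subseteq> X \<longrightarrow> Y \<in> \<I>) \<and>
     (\<forall>X\<in>\<I>. \<forall>Y\<in>\<I>. card X < card Y \<longrightarrow> (\<exists>e\<in>Y - X. insert e X \<in> \<I>))"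

definition is_basis :: "nat set set \<Rightarrow> nat set \<Rightarrow> bool" where
  "is_basis \<I> B \<longleftrightarrow> B \<in> \<I> \<and> (\<forall>X\<in>\<I>. B \<subseteq> X \<longrightarrow> X = B)"

definition has_rank :: "nat set set \<Rightarrow> nat \<Rightarrow> bool" where
  "has_rank \<I> K \<longleftrightarrow> (\<forall>B. is_basis \<I> B \<longrightarrow> card B = K)"

definition aug_set :: "nat \<Rightarrow> nat set set \<Rightarrow> nat set \<Rightarrow> nat set" where
  "aug_set L \<I> X = {e \<in> {1..L} - X. insert e X \<in> \<I>}"

definition fval :: "nat set \<Rightarrow> (nat \<Rightarrow> real) \<Rightarrow> real" where
  "fval A w = (\<Sum>e\<in>A. w e)"

definition conf :: "nat \<Rightarrow> nat \<Rightarrow> real" where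
  "conf t s = (if t = 0 then 0 else sqrt (2 * ln (real t) / real s))"

text \<open>Items ordered by decreasing U; sort_key is stable (insertion sort), so ties are broken by smaller index first.\<close>
definition omm_order :: "nat \<Rightarrow> (nat \<Rightarrow> real) \<Rightarrow> nat list" where
  "omm_order L U = sort_key (\<lambda>e. - U e) [1..<Suc L]"

definition omm_greedy :: "nat \<Rightarrow> nat set set \<Rightarrow> (nat \<Rightarrow> real) \<Rightarrow> nat set" where
  "omm_greedy L \<I> U =
     foldl (\<lambda>A e. if e \<in> aug_set L \<I> A then insert e A else A) {} (omm_order L U)"

text \<open>State after episode t: (T_e(t), \<hat>w_{e,T_e(t)}), given the weight sequence ws.
  U_t(e) = \<hat>w_{e,T_e(t-1)} + c_{t-1,T_e(t-1)}.\<close>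
definition omm_ucb :: "nat \<Rightarrow> (nat \<Rightarrow> nat) \<times> (nat \<Rightarrow> real) \<Rightarrow> nat \<Rightarrow> real" where
  "omm_ucb t st e = snd st e + conf (t - 1) (fst st e)"

fun omm_state :: "nat \<Rightarrow> nat set set \<Rightarrow> (nat \<Rightarrow> nat \<Rightarrow> real) \<Rightarrow> nat
                    \<Rightarrow> (nat \<Rightarrow> nat) \<times> (nat \<Rightarrow> real)" where
  "omm_state L \<I> ws 0 = ((\<lambda>e. 1), (\<lambda>e. ws 0 e))"
| "omm_state L \<I> ws (Suc t) =
     (let st = omm_state L \<I> ws t;
          A = omm_greedy L \<I> (omm_ucb (Suc t) st)
      in ((\<lambda>e. fst st e + (if e \<in> A then 1 else 0)),
          (\<lambda>e. if e \<in> A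
                then (real (fst st e) * snd st e + ws (Suc t) e) / real (fst st e + 1)
                else snd st e)))"

definition omm_action :: "nat \<Rightarrow> nat set set \<Rightarrow> (nat \<Rightarrow> nat \<Rightarrow> real) \<Rightarrow> nat \<Rightarrow> nat set" where
  "omm_action L \<I> ws t = omm_greedy L \<I> (omm_ucb t (omm_state L \<I> ws (t - 1)))"

definition weight_space :: "nat \<Rightarrow> (nat \<Rightarrow> real) measure" where
  "weight_space L = Pi\<^sub>M {1..L} (\<lambda>_. borel)"

end

theory Submission
  imports Defs
begin

text \<open>Each episode's expected regret equals the expected gap \<open>f(A\<^sup>*, w) - f(A\<^sup>t, w)\<close> for the mean weights \<open>w\<close>, since the
  action depends only on earlier weights. If all estimates lie within their confidence radii, then
  optimality of the greedy basis for the optimistic weights bounds this gap by twice the sum of the radii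
  over the chosen items; summing \<open>1 / sqrt T\<close> along each counter and Cauchy--Schwarz over the items give the
  \<open>sqrt (K L n log n)\<close> term. Otherwise the gap is at most \<open>K\<close>. Observation times are random, so the
  estimates are not means of independent samples; their deviations are controlled by the nonnegative
  supermartingale \<open>exp (l T (w\<^sub>T - w) - l\<^sup>2 T / 8)\<close>, where \<open>w\<^sub>T\<close> is the estimate after \<open>T\<close> observations and
  \<open>w\<close> the mean, and a union bound over the value of \<open>T\<close>.\<close>

section \<open>The greedy algorithm on a matroid\<close>

definition greedy_list :: "nat \<Rightarrow> nat set set \<Rightarrow> nat list \<Rightarrow> nat set" where
  "greedy_list L \<I> xs = foldl (\<lambda>A e. if e \<in> aug_set L \<I> A then insert e A else A) {} xs"

lemma greedy_list_snoc:
  "greedy_list L \<I> (xs @ [x]) =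
     (if x \<in> aug_set L \<I> (greedy_list L \<I> xs) then insert x (greedy_list L \<I> xs) else greedy_list L \<I> xs)"
  by (simp add: greedy_list_def)

lemma matroid_finite: "matroid L \<I> \<Longrightarrow> X \<in> \<I> \<Longrightarrow> finite X"
  unfolding matroid_def by (meson finite_atLeastAtMost finite_subset)

text \<open>Maximality survives each further step by downward closure: an item whose addition to a
  set is dependent stays dependent with every larger set, so a rejected item never becomes
  admissible again.\<close>

lemma greedy_list_maximal_independent:
  assumes M: "matroid L \<I>" and "set xs \<subseteq> {1..L}"
  shows "greedy_list L \<I> xs \<in> \<I> \<and> greedy_list L \<I> xs \<subseteq> set xs \<and>
         (\<forall>e\<in>set xs - greedy_list L \<I> xs. insert e (greedy_list L \<I> xs) \<notin> \<I>)"
  using assms(2)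
proof (induction xs rule: rev_induct)
  case Nil
  then show ?case using M by (simp add: greedy_list_def matroid_def)
next
  case (snoc x xs)
  let ?A = "greedy_list L \<I> xs"
  have IH: "?A \<in> \<I>" "?A \<subseteq> set xs" "\<And>e. e \<in> set xs - ?A \<Longrightarrow> insert e ?A \<notin> \<I>"
    using snoc by auto
  have down: "\<And>X Y. X \<in> \<I> \<Longrightarrow> Y \<subseteq> X \<Longrightarrow> Y \<in> \<I>"
    using M unfolding matroid_def by blast
  show ?case
  proof (cases "x \<in> aug_set L \<I> ?A")
    case True
    have "insert e (insert x ?A) \<notin> \<I>" if "e \<in> set xs - ?A" for e
      using IH(3)[OF that] down[of "insert e (insert x ?A)" "insert e ?A"] by blast
    then show ?thesis using True IH by (auto simp: greedy_list_snoc aug_set_def)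
  next
    case False
    then show ?thesis using IH snoc.prems by (auto simp: greedy_list_snoc aug_set_def)
  qed
qed

text \<open>A larger independent set inside \<open>set xs\<close> would, by augmentation, supply an
  item of \<open>set xs\<close> that still fits, contradicting maximality. Only
  \<open>set xs\<close> matters here, so the bound applies to every prefix of the ordered list,
  which is how the optimality proof uses it.\<close>

lemma card_independent_le_card_greedy_list:
  assumes M: "matroid L \<I>" and xs: "set xs \<subseteq> {1..L}" and B: "B \<in> \<I>" "B \<subseteq> set xs"
  shows "card B \<le> card (greedy_list L \<I> xs)"
proof (rule ccontr)
  let ?A = "greedy_list L \<I> xs"
  note A = greedy_list_maximal_independent[OF M xs]
  assume "\<not> card B \<le> card ?A"
  then obtain e where "e \<in> B - ?A" "insert e ?A \<in> \<I>"
    using M A B(1) unfolding matroid_def by (meson linorder_not_le)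
  then show False using A B(2) by blast
qed

(* The threshold m is a parameter of the induction: when x is appended, the induction hypothesis is
   used at m = U x, and the remaining term is (U x - m) times a cardinality. *)
lemma greedy_list_optimal_above_threshold:
  fixes U :: "nat \<Rightarrow> real"
  assumes M: "matroid L \<I>" and "set xs \<subseteq> {1..L}" and "sorted (map (\<lambda>e. - U e) xs)"
    and "B \<in> \<I>" and "B \<subseteq> set xs" and "\<forall>e\<in>set xs. m \<le> U e"
  shows "(\<Sum>e\<in>B. U e - m) \<le> (\<Sum>e\<in>greedy_list L \<I> xs. U e - m)"
  using assms(2-)
proof (induction xs arbitrary: B m rule: rev_induct)
  case Nil
  then show ?case by (simp add: greedy_list_def)
next
  case (snoc x xs)
  let ?A = "greedy_list L \<I> xs" and ?A' = "greedy_list L \<I> (xs @ [x])"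
  have Bx: "B - {x} \<in> \<I>" using M snoc.prems(3) unfolding matroid_def by blast
  have fin: "finite B" "finite ?A" "finite ?A'"
    using matroid_finite[OF M] snoc.prems greedy_list_maximal_independent[OF M] by auto
  have "(\<Sum>e\<in>B. U e - m) = (\<Sum>e\<in>B. U e - U x) + real (card B) * (U x - m)"
    by (simp add: sum_subtractf algebra_simps)
  also have "(\<Sum>e\<in>B. U e - U x) = (\<Sum>e\<in>B - {x}. U e - U x)"
    using fin by (intro sum.mono_neutral_right) auto
  also have "\<dots> \<le> (\<Sum>e\<in>?A. U e - U x)"
    using snoc.prems by (intro snoc.IH Bx) (auto simp: sorted_append)
  also have "\<dots> = (\<Sum>e\<in>?A'. U e - U x)"
    using fin by (simp add: greedy_list_snoc sum.insert_if)
  also have "real (card B) * (U x - m) \<le> real (card ?A') * (U x - m)"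
    using card_independent_le_card_greedy_list[OF M, of "xs @ [x]" B] snoc.prems
    by (intro mult_right_mono) auto
  also have "(\<Sum>e\<in>?A'. U e - U x) + real (card ?A') * (U x - m) = (\<Sum>e\<in>?A'. U e - m)"
    by (simp add: sum_subtractf algebra_simps)
  finally show ?case by simp
qed

lemma omm_greedy_eq: "omm_greedy L \<I> U = greedy_list L \<I> (omm_order L U)"
  by (simp add: omm_greedy_def greedy_list_def)

lemma set_omm_order [simp]: "set (omm_order L U) = {1..L}"
  by (auto simp: omm_order_def)

lemma omm_greedy_subset: "matroid L \<I> \<Longrightarrow> omm_greedy L \<I> U \<subseteq> {1..L}"
  using greedy_list_maximal_independent[of L \<I> "omm_order L U"] by (simp add: omm_greedy_eq)

lemma omm_greedy_is_basis:
  assumes M: "matroid L \<I>"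
  shows "is_basis \<I> (omm_greedy L \<I> U)"
proof -
  let ?A = "omm_greedy L \<I> U"
  have A: "?A \<in> \<I>" "\<And>e. e \<in> {1..L} - ?A \<Longrightarrow> insert e ?A \<notin> \<I>"
    using greedy_list_maximal_independent[OF M, of "omm_order L U"] by (auto simp: omm_greedy_eq)
  have "X = ?A" if X: "X \<in> \<I>" "?A \<subseteq> X" for X
  proof (rule ccontr)
    assume "X \<noteq> ?A"
    then obtain e where e: "e \<in> X" "e \<notin> ?A" using X by auto
    then have "insert e ?A \<in> \<I>" "e \<in> {1..L}"
      using M X unfolding matroid_def by (meson insert_subset subsetD)+
    then show False using A(2) e by blast
  qed
  then show ?thesis using A(1) by (simp add: is_basis_def)
qed

lemma card_omm_greedy: "matroid L \<I> \<Longrightarrow> has_rank \<I> K \<Longrightarrow> card (omm_greedy L \<I> U) = K"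
  using omm_greedy_is_basis by (simp add: has_rank_def)

lemma omm_greedy_optimal:
  assumes M: "matroid L \<I>" and K: "has_rank \<I> K" and B: "is_basis \<I> B"
  shows "fval B U \<le> fval (omm_greedy L \<I> U) U"
proof -
  let ?A = "omm_greedy L \<I> U"
  \<comment> \<open>The threshold lemma needs a lower bound of the weights, whatever their sign. The
    shift by \<open>m\<close> cancels at the end because both bases have \<open>K\<close>
    elements.\<close>
  define m where "m = Min (U ` {1..L})"
  have BI: "B \<in> \<I>" "B \<subseteq> {1..L}" "card B = K"
    using B M K unfolding is_basis_def matroid_def has_rank_def by auto
  have "(\<Sum>e\<in>B. U e - m) \<le> (\<Sum>e\<in>?A. U e - m)"
    unfolding omm_greedy_eq
    by (intro greedy_list_optimal_above_threshold M) (use BI in \<open>auto simp: omm_order_def m_def\<close>)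
  then show ?thesis
    using card_omm_greedy[OF M K] BI by (simp add: sum_subtractf fval_def)
qed

section \<open>Dependence of the greedy set on comparisons only, and its measurability\<close>

lemma insort_key_cong_le:
  assumes "\<And>y. y \<in> set xs \<Longrightarrow> f x \<le> f y \<longleftrightarrow> g x \<le> g y"
  shows "insort_key f x xs = insort_key g x xs"
  using assms by (induction xs) auto

lemma sort_key_cong_le:
  assumes "\<And>x y. x \<in> set xs \<Longrightarrow> y \<in> set xs \<Longrightarrow> f x \<le> f y \<longleftrightarrow> g x \<le> g y"
  shows "sort_key f xs = sort_key g xs"
  using assms
proof (induction xs)
  case (Cons x xs)
  have "sort_key f xs = sort_key g xs" using Cons by auto
  then show ?case using Cons.prems by (auto intro!: insort_key_cong_le)
qed simp

text \<open>The weights enter only through the sorting, and insertion sort only compares keys; ties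
  are resolved by position in the list, the same for \<open>U\<close> and \<open>V\<close>.\<close>

lemma omm_greedy_cong_le:
  assumes "\<And>a b. a \<in> {1..L} \<Longrightarrow> b \<in> {1..L} \<Longrightarrow> U a \<le> U b \<longleftrightarrow> V a \<le> V b"
  shows "omm_greedy L \<I> U = omm_greedy L \<I> V"
proof -
  have "omm_order L U = omm_order L V"
    unfolding omm_order_def using assms by (intro sort_key_cong_le) auto
  then show ?thesis by (simp add: omm_greedy_def)
qed

(* The greedy set depends on U only through the relation U a <= U b, which takes finitely many values. *)
lemma sets_omm_greedy_eq:
  assumes U: "\<And>e. e \<in> {1..L} \<Longrightarrow> (\<lambda>x. U x e) \<in> borel_measurable N"
  shows "{x \<in> space N. omm_greedy L \<I> (U x) = A} \<in> sets N"
proof -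
  define R where "R x = {(a, b). a \<in> {1..L} \<and> b \<in> {1..L} \<and> U x a \<le> U x b}" for x
  have R: "R x \<in> Pow ({1..L} \<times> {1..L})" for x by (auto simp: R_def)
  have cong: "omm_greedy L \<I> (U x) = omm_greedy L \<I> (U y)" if "R x = R y" for x y
    using that by (intro omm_greedy_cong_le) (auto simp: R_def set_eq_iff)
  have meas: "{x \<in> space N. R x = r} \<in> sets N" if r: "r \<in> Pow ({1..L} \<times> {1..L})" for r
  proof -
    have eq: "{x \<in> space N. R x = r} =
        {x \<in> space N. \<forall>a\<in>{1..L}. \<forall>b\<in>{1..L}. (U x a \<le> U x b) = ((a, b) \<in> r)}"
    proof (intro Collect_cong conj_cong refl iffI)
      fix x assume "\<forall>a\<in>{1..L}. \<forall>b\<in>{1..L}. (U x a \<le> U x b) = ((a, b) \<in> r)"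
      with r show "R x = r" unfolding R_def by blast
    qed (auto simp: R_def)
    have [measurable]: "{x \<in> space N. (U x a \<le> U x b) = ((a, b) \<in> r)} \<in> sets N"
      if "a \<in> {1..L}" "b \<in> {1..L}" for a b
    proof -
      note U[OF that(1), measurable] U[OF that(2), measurable]
      show ?thesis by measurable
    qed
    show ?thesis unfolding eq by (intro sets.sets_Collect_finite_All) auto
  qed
  \<comment> \<open>By \<open>cong\<close>, the event is the union of the fibres of \<open>R\<close>
    over the relations that produce \<open>A\<close>, a finite union.\<close>
  define good where "good = {r \<in> Pow ({1..L} \<times> {1..L}). \<exists>x. R x = r \<and> omm_greedy L \<I> (U x) = A}"
  have eq: "{x \<in> space N. omm_greedy L \<I> (U x) = A} = (\<Union>r\<in>good. {x \<in> space N. R x = r})"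
  proof (intro equalityI subsetI)
    fix x assume "x \<in> {x \<in> space N. omm_greedy L \<I> (U x) = A}"
    moreover from this R[of x] have "R x \<in> good" unfolding good_def by blast
    ultimately show "x \<in> (\<Union>r\<in>good. {x \<in> space N. R x = r})" by blast
  next
    fix x assume "x \<in> (\<Union>r\<in>good. {x \<in> space N. R x = r})"
    then obtain y where "x \<in> space N" "R x = R y" "omm_greedy L \<I> (U y) = A"
      unfolding good_def by blast
    then show "x \<in> {x \<in> space N. omm_greedy L \<I> (U x) = A}" using cong[of x y] by simp
  qed
  have "finite good" by (simp add: good_def)
  then show ?thesis unfolding eq by (intro sets.finite_UN meas) (auto simp: good_def)
qed

lemma sets_omm_greedy_mem:
  assumes M: "matroid L \<I>" and U: "\<And>e. e \<in> {1..L} \<Longrightarrow> (\<lambda>x. U x e) \<in> borel_measurable N"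
  shows "{x \<in> space N. e \<in> omm_greedy L \<I> (U x)} \<in> sets N"
proof -
  have "{x \<in> space N. e \<in> omm_greedy L \<I> (U x)} =
      (\<Union>A\<in>{A \<in> Pow {1..L}. e \<in> A}. {x \<in> space N. omm_greedy L \<I> (U x) = A})"
    using omm_greedy_subset[OF M] by fastforce
  then show ?thesis using sets_omm_greedy_eq[OF U] by (auto intro!: sets.finite_UN)
qed

section \<open>The recursion of the algorithm and its dependence on past weights\<close>

lemma fst_omm_state_Suc:
  "fst (omm_state L \<I> ws (Suc t)) e =
     fst (omm_state L \<I> ws t) e + (if e \<in> omm_action L \<I> ws (Suc t) then 1 else 0)"
  by (simp add: omm_action_def Let_def)

lemma snd_omm_state_Suc:
  "snd (omm_state L \<I> ws (Suc t)) e =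
     (if e \<in> omm_action L \<I> ws (Suc t)
      then (real (fst (omm_state L \<I> ws t) e) * snd (omm_state L \<I> ws t) e + ws (Suc t) e)
             / real (fst (omm_state L \<I> ws t) e + 1)
      else snd (omm_state L \<I> ws t) e)"
  by (simp add: omm_action_def Let_def)

declare omm_state.simps(2) [simp del]

lemma omm_state_counter_bounds: "1 \<le> fst (omm_state L \<I> ws t) e \<and> fst (omm_state L \<I> ws t) e \<le> t + 1"
  by (induction t) (auto simp: fst_omm_state_Suc)

lemma omm_state_cong:
  assumes "\<And>s. s \<le> t \<Longrightarrow> ws s = ws' s"
  shows "omm_state L \<I> ws t = omm_state L \<I> ws' t"
  using assms
proof (induction t)
  case (Suc t)
  then have "omm_state L \<I> ws t = omm_state L \<I> ws' t" "ws (Suc t) = ws' (Suc t)" by auto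
  then show ?case by (simp only: omm_state.simps(2))
qed simp

text \<open>The action is predictable: it is fixed before the weights of its own episode are
  revealed. Positivity of \<open>t\<close> matters because \<open>t - 1\<close> is truncated, so
  that the action at index 0 would read \<open>ws 0\<close>.\<close>

lemma omm_action_cong:
  assumes "\<And>s. s < t \<Longrightarrow> ws s = ws' s" and "0 < t"
  shows "omm_action L \<I> ws t = omm_action L \<I> ws' t"
  unfolding omm_action_def using assms by (subst omm_state_cong[of "t - 1" ws ws']) auto

section \<open>Summing the confidence radii along a run\<close>

lemma conf_nonneg: "0 \<le> conf t s"
  by (cases t) (auto simp: conf_def)

lemma conf_le: "t < n \<Longrightarrow> conf t s \<le> sqrt (2 * ln (real n)) / sqrt (real s)"
  by (auto simp: conf_def real_sqrt_divide intro!: divide_right_mono)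

text \<open>The inequality \<open>2 a b <= a^2 + b^2\<close> for \<open>sqrt (x - 1)\<close> and
  \<open>sqrt x\<close>, divided by \<open>sqrt x\<close>. It is the telescoping step for sums of
  \<open>1 / sqrt T\<close>.\<close>

lemma sqrt_pred_plus_inverse_sqrt_le:
  fixes x :: real assumes "1 \<le> x"
  shows "2 * sqrt (x - 1) + 1 / sqrt x \<le> 2 * sqrt x"
proof -
  have "2 * (sqrt (x - 1) * sqrt x) \<le> (sqrt (x - 1))\<^sup>2 + (sqrt x)\<^sup>2"
    by (metis mult.assoc sum_squares_bound)
  also have "\<dots> = 2 * x - 1" using assms by simp
  finally have "2 * sqrt (x - 1) * sqrt x + 1 \<le> 2 * (sqrt x * sqrt x)" using assms by simp
  then have "(2 * sqrt (x - 1) * sqrt x + 1) / sqrt x \<le> (2 * sqrt x) * sqrt x / sqrt x"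
    using assms by (intro divide_right_mono) (auto simp: mult.assoc)
  also have "\<dots> = 2 * sqrt x"
    using assms by (intro nonzero_mult_div_cancel_right) auto
  finally show ?thesis using assms by (simp add: add_divide_distrib)
qed

text \<open>Only episodes choosing \<open>e\<close> contribute. In such an episode the counter moves
  from \<open>x\<close> to \<open>x + 1\<close>, the left side gains \<open>1 / sqrt x\<close>, and
  the right side rises from \<open>2 * sqrt (x - 1)\<close> to \<open>2 * sqrt x\<close>. The
  counter starts at 1, where the bound is 0.\<close>

lemma sum_inverse_sqrt_counter_le:
  "(\<Sum>t\<in>{1..n}. if e \<in> omm_action L \<I> ws t then 1 / sqrt (real (fst (omm_state L \<I> ws (t - 1)) e)) else 0)
     \<le> 2 * sqrt (real (fst (omm_state L \<I> ws n) e) - 1)"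
proof (induction n)
  case (Suc n)
  have "{1..Suc n} = insert (Suc n) {1..n}" by auto
  then show ?case
    using Suc sqrt_pred_plus_inverse_sqrt_le[of "real (fst (omm_state L \<I> ws n) e)"] omm_state_counter_bounds[of L \<I> ws n e]
    by (auto simp: fst_omm_state_Suc)
qed simp

text \<open>Every action is a basis, so each episode advances exactly \<open>K\<close> counters;
  subtracting 1 discards the initial observation of each item.\<close>

lemma sum_counters:
  assumes M: "matroid L \<I>" and K: "has_rank \<I> K"
  shows "(\<Sum>e\<in>{1..L}. real (fst (omm_state L \<I> ws n) e) - 1) = real K * real n"
proof (induction n)
  case (Suc n)
  let ?A = "omm_action L \<I> ws (Suc n)"
  have A: "?A \<subseteq> {1..L}" "card ?A = K"
    using omm_greedy_subset[OF M] card_omm_greedy[OF M K] by (auto simp: omm_action_def)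
  have "(\<Sum>e\<in>{1..L}. real (fst (omm_state L \<I> ws (Suc n)) e) - 1) =
      (\<Sum>e\<in>{1..L}. (real (fst (omm_state L \<I> ws n) e) - 1) + (if e \<in> ?A then 1 else 0))"
    by (intro sum.cong) (auto simp: fst_omm_state_Suc)
  also have "\<dots> = real K * real n + real (card ?A)"
    unfolding sum.distrib Suc using A by (simp add: sum.If_cases Int_absorb1)
  finally show ?case using A by (simp add: algebra_simps)
qed simp

lemma sum_conf_le:
  assumes M: "matroid L \<I>" and K: "has_rank \<I> K"
  shows "(\<Sum>t\<in>{1..n}. \<Sum>e\<in>omm_action L \<I> ws t. 2 * conf (t - 1) (fst (omm_state L \<I> ws (t - 1)) e))
       \<le> 8 * sqrt (real K * real L * real n * ln (real n))"
proof (cases "n = 0")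
  case False
  let ?T = "\<lambda>t e. real (fst (omm_state L \<I> ws t) e)"
  let ?l = "sqrt (2 * ln (real n))"
  have A: "omm_action L \<I> ws t \<subseteq> {1..L}" for t
    using omm_greedy_subset[OF M] by (auto simp: omm_action_def)
  \<comment> \<open>Replacing the logarithm by \<open>ln n\<close> leaves a common factor times
    \<open>1 / sqrt T\<close>.\<close>
  have "(\<Sum>t\<in>{1..n}. \<Sum>e\<in>omm_action L \<I> ws t. 2 * conf (t - 1) (fst (omm_state L \<I> ws (t - 1)) e))
      \<le> (\<Sum>t\<in>{1..n}. \<Sum>e\<in>omm_action L \<I> ws t. 2 * (?l / sqrt (?T (t - 1) e)))"
    by (intro sum_mono mult_left_mono conf_le) auto
  \<comment> \<open>Extending the inner sum to all items by an indicator makes its range independent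
    of \<open>t\<close>, so that the two sums can be exchanged.\<close>
  also have "\<dots> = (\<Sum>t\<in>{1..n}. \<Sum>e\<in>{1..L}. 2 * ?l * (if e \<in> omm_action L \<I> ws t then 1 / sqrt (?T (t - 1) e) else 0))"
    using A by (intro sum.cong refl sum.mono_neutral_cong_left) auto
  also have "\<dots> = 2 * ?l * (\<Sum>e\<in>{1..L}. \<Sum>t\<in>{1..n}. (if e \<in> omm_action L \<I> ws t then 1 / sqrt (?T (t - 1) e) else 0))"
    by (subst sum.swap) (simp add: sum_distrib_left)
  also have "\<dots> \<le> 2 * ?l * (\<Sum>e\<in>{1..L}. 2 * sqrt (?T n e - 1))"
    using False by (intro mult_left_mono sum_mono sum_inverse_sqrt_counter_le) auto
  \<comment> \<open>The factor 1 displays the sum as an inner product with the constant vector,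
    ready for Cauchy--Schwarz; the squared roots then add up to \<open>K * n\<close> by
    \<open>sum_counters\<close>.\<close>
  also have "\<dots> = 4 * ?l * (\<Sum>e\<in>{1..L}. 1 * sqrt (?T n e - 1))"
    by (simp add: sum_distrib_left algebra_simps)
  also have "\<dots> \<le> 4 * ?l * sqrt (real L * (real K * real n))"
  proof (intro mult_left_mono real_le_rsqrt)
    have "(\<Sum>e\<in>{1..L}. 1 * sqrt (?T n e - 1))\<^sup>2 \<le> (\<Sum>e\<in>{1..L}. 1\<^sup>2) * (\<Sum>e\<in>{1..L}. (sqrt (?T n e - 1))\<^sup>2)"
      by (rule Cauchy_Schwarz_ineq_sum)
    also have "(\<Sum>e\<in>{1..L}. (sqrt (?T n e - 1))\<^sup>2) = (\<Sum>e\<in>{1..L}. ?T n e - 1)"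
      using omm_state_counter_bounds[of L \<I> ws n] by (intro sum.cong) auto
    finally show "(\<Sum>e\<in>{1..L}. 1 * sqrt (?T n e - 1))\<^sup>2 \<le> real L * (real K * real n)"
      using sum_counters[OF M K] by simp
  qed (use False in auto)
  also have "\<dots> = 4 * sqrt 2 * sqrt (real K * real L * real n * ln (real n))"
    by (simp add: real_sqrt_mult)
  \<comment> \<open>The argument gives the constant \<open>4 * sqrt 2\<close>, which is rounded up
    to 8.\<close>
  also have "\<dots> \<le> 8 * sqrt (real K * real L * real n * ln (real n))"
  proof (intro mult_right_mono)
    have "sqrt 2 \<le> (2::real)" by (intro real_le_lsqrt) auto
    then show "4 * sqrt 2 \<le> (8::real)" by simp
  qed (use False in auto)
  finally show ?thesis .
qed simp

section \<open>Measurability of counters, estimates and actions\<close>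

lemma sets_omm_action_mem:
  assumes M: "matroid L \<I>"
    and T: "\<And>e. e \<in> {1..L} \<Longrightarrow> (\<lambda>x. real (fst (omm_state L \<I> (ws x) t) e)) \<in> borel_measurable N"
    and w: "\<And>e. e \<in> {1..L} \<Longrightarrow> (\<lambda>x. snd (omm_state L \<I> (ws x) t) e) \<in> borel_measurable N"
  shows "{x \<in> space N. e \<in> omm_action L \<I> (ws x) (Suc t)} \<in> sets N"
proof -
  have "(\<lambda>x. omm_ucb (Suc t) (omm_state L \<I> (ws x) t) e) \<in> borel_measurable N" if "e \<in> {1..L}" for e
  proof -
    note T[OF that, measurable] w[OF that, measurable]
    show ?thesis unfolding omm_ucb_def conf_def by measurable
  qed
  from sets_omm_greedy_mem[OF M this] show ?thesis by (simp add: omm_action_def)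
qed

text \<open>The source space \<open>N\<close> and the map \<open>ws\<close> are left general because
  the result is needed both on the probability space and on the product space of finite
  histories.\<close>

lemma borel_measurable_omm_state:
  assumes M: "matroid L \<I>" and e: "e \<in> {1..L}"
    and ws: "\<And>s e. s \<le> t \<Longrightarrow> e \<in> {1..L} \<Longrightarrow> (\<lambda>x. ws x s e) \<in> borel_measurable N"
  shows "(\<lambda>x. real (fst (omm_state L \<I> (ws x) t) e)) \<in> borel_measurable N"
    and "(\<lambda>x. snd (omm_state L \<I> (ws x) t) e) \<in> borel_measurable N"
proof -
  \<comment> \<open>Both claims are proved together and for all items at once, since the next action
    compares the indices of all items, built from counters and estimates.\<close>
  have "(\<lambda>x. real (fst (omm_state L \<I> (ws x) t) e)) \<in> borel_measurable N \<and>
        (\<lambda>x. snd (omm_state L \<I> (ws x) t) e) \<in> borel_measurable N"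
    using e ws
  proof (induction t arbitrary: e)
    case (Suc t)
    have IH: "(\<lambda>x. real (fst (omm_state L \<I> (ws x) t) e)) \<in> borel_measurable N"
      "(\<lambda>x. snd (omm_state L \<I> (ws x) t) e) \<in> borel_measurable N" if "e \<in> {1..L}" for e
      using Suc.IH[OF that] Suc.prems(2) by auto
    note IH[OF Suc.prems(1), measurable] Suc.prems(2)[OF le_refl Suc.prems(1), measurable]
    have [measurable]: "{x \<in> space N. e \<in> omm_action L \<I> (ws x) (Suc t)} \<in> sets N"
      by (rule sets_omm_action_mem[OF M]) (rule IH; assumption)+
    have "(\<lambda>x. real (fst (omm_state L \<I> (ws x) t) e) +
        (if e \<in> omm_action L \<I> (ws x) (Suc t) then 1 else 0)) \<in> borel_measurable N"
      by measurable
    moreover have "(\<lambda>x. if e \<in> omm_action L \<I> (ws x) (Suc t)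
        then (real (fst (omm_state L \<I> (ws x) t) e) * snd (omm_state L \<I> (ws x) t) e + ws x (Suc t) e)
               / (real (fst (omm_state L \<I> (ws x) t) e) + 1)
        else snd (omm_state L \<I> (ws x) t) e) \<in> borel_measurable N"
      by measurable
    ultimately show ?case
      by (simp add: fst_omm_state_Suc snd_omm_state_Suc of_nat_add if_distrib add.commute cong: if_cong)
  qed auto
  then show "(\<lambda>x. real (fst (omm_state L \<I> (ws x) t) e)) \<in> borel_measurable N"
    and "(\<lambda>x. snd (omm_state L \<I> (ws x) t) e) \<in> borel_measurable N" by auto
qed

lemma sets_omm_action_mem_weights:
  assumes M: "matroid L \<I>"
    and ws: "\<And>s e. s \<le> t \<Longrightarrow> e \<in> {1..L} \<Longrightarrow> (\<lambda>x. ws x s e) \<in> borel_measurable N"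
  shows "{x \<in> space N. e \<in> omm_action L \<I> (ws x) (Suc t)} \<in> sets N"
  by (rule sets_omm_action_mem[OF M]) (rule borel_measurable_omm_state[OF M _ ws]; assumption)+

section \<open>Exponential moments of bounded variables and of the estimates\<close>

lemma (in prob_space) nn_integral_exp_centered_le_1:
  fixes X :: "'a \<Rightarrow> real"
  assumes X [measurable]: "random_variable borel X" and bnd: "AE x in M. X x \<in> {0..1}"
  shows "(\<integral>\<^sup>+x. ennreal (exp (l * (X x - expectation X) - l\<^sup>2 / 8)) \<partial>M) \<le> 1"
proof -
  have "(\<integral>\<^sup>+x. ennreal (exp (l * (X x - expectation X))) \<partial>M) \<le> ennreal (exp (l\<^sup>2 / 8))"
  proof (cases l "0::real" rule: linorder_cases)
    \<comment> \<open>Hoeffding's lemma is applied with a positive parameter, so a negative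
      \<open>l\<close> is handled by \<open>- X\<close>, which ranges over an interval of the same
      length 1.\<close>
    case less
    interpret Y: interval_bounded_random_variable M "\<lambda>x. - X x" "-1" 0
      by unfold_locales (use bnd in auto)
    show ?thesis using Y.Hoeffdings_lemma_nn_integral[of "- l"] less by (simp add: algebra_simps)
  next
    case equal
    then show ?thesis by (simp add: emeasure_space_1)
  next
    case greater
    interpret Y: interval_bounded_random_variable M X 0 1
      by unfold_locales (use bnd in auto)
    show ?thesis using Y.Hoeffdings_lemma_nn_integral[of l] greater by simp
  qed
  then have "(\<integral>\<^sup>+x. ennreal (exp (l * (X x - expectation X))) \<partial>M) * ennreal (exp (- (l\<^sup>2 / 8)))
      \<le> ennreal (exp (l\<^sup>2 / 8)) * ennreal (exp (- (l\<^sup>2 / 8)))"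
    by (rule mult_right_mono) simp
  also have "\<dots> = 1" by (simp flip: ennreal_mult exp_add)
  also have "(\<integral>\<^sup>+x. ennreal (exp (l * (X x - expectation X))) \<partial>M) * ennreal (exp (- (l\<^sup>2 / 8)))
      = (\<integral>\<^sup>+x. ennreal (exp (l * (X x - expectation X) - l\<^sup>2 / 8)) \<partial>M)"
    by (subst nn_integral_multc[symmetric]) (auto simp flip: ennreal_mult exp_add)
  finally show ?thesis .
qed

text \<open>The joint law is the product law, so Tonelli applies. Working with nonnegative integrals
  avoids integrability conditions on the exponentials.\<close>

lemma (in prob_space) indep_var_nn_integral_mult:
  fixes X Y :: "'a \<Rightarrow> ennreal"
  assumes ind: "indep_var borel X borel Y"
  shows "(\<integral>\<^sup>+x. X x * Y x \<partial>M) = (\<integral>\<^sup>+x. X x \<partial>M) * (\<integral>\<^sup>+x. Y x \<partial>M)"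
proof -
  have rv [measurable]: "random_variable borel X" "random_variable borel Y"
    and eq: "distr M borel X \<Otimes>\<^sub>M distr M borel Y = distr M (borel \<Otimes>\<^sub>M borel) (\<lambda>x. (X x, Y x))"
    using ind unfolding indep_var_distribution_eq by auto
  interpret Y: prob_space "distr M borel Y" by (rule prob_space_distr) fact
  have "(\<integral>\<^sup>+x. X x * Y x \<partial>M) = (\<integral>\<^sup>+z. fst z * snd z \<partial>distr M (borel \<Otimes>\<^sub>M borel) (\<lambda>x. (X x, Y x)))"
    by (subst nn_integral_distr) auto
  also have "\<dots> = (\<integral>\<^sup>+x. \<integral>\<^sup>+y. x * y \<partial>distr M borel Y \<partial>distr M borel X)"
    unfolding eq[symmetric] by (subst Y.nn_integral_fst[symmetric]) auto
  also have "\<dots> = (\<integral>\<^sup>+x. X x \<partial>M) * (\<integral>\<^sup>+x. Y x \<partial>M)"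
    by (simp add: nn_integral_cmult nn_integral_multc nn_integral_distr)
  finally show ?thesis .
qed

lemma weight_space_component [measurable]: "e \<in> {1..L} \<Longrightarrow> (\<lambda>w. w e) \<in> borel_measurable (weight_space L)"
  unfolding weight_space_def by simp

text \<open>Taking the weight sequence as argument, rather than a point of the probability space,
  allows evaluation on finite histories as well.\<close>

definition deviation_exp ::
  "nat \<Rightarrow> nat set set \<Rightarrow> nat \<Rightarrow> real \<Rightarrow> real \<Rightarrow> nat \<Rightarrow> (nat \<Rightarrow> nat \<Rightarrow> real) \<Rightarrow> real" where
  "deviation_exp L \<I> e m l t ws =
     (let T = real (fst (omm_state L \<I> ws t) e)
      in exp (l * (T * (snd (omm_state L \<I> ws t) e - m)) - l\<^sup>2 / 8 * T))"

text \<open>The counter times the centred estimate is the sum of the centred observations, so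
  choosing \<open>e\<close> adds the single summand \<open>ws (Suc t) e - m\<close>; otherwise
  nothing changes.\<close>

lemma deviation_exp_Suc:
  "deviation_exp L \<I> e m l (Suc t) ws = deviation_exp L \<I> e m l t ws *
     (if e \<in> omm_action L \<I> ws (Suc t) then exp (l * (ws (Suc t) e - m) - l\<^sup>2 / 8) else 1)"
proof (cases "e \<in> omm_action L \<I> ws (Suc t)")
  case True
  let ?T = "real (fst (omm_state L \<I> ws t) e)" and ?w = "snd (omm_state L \<I> ws t) e"
  have "(?T + 1) * ((?T * ?w + ws (Suc t) e) / (?T + 1) - m) = ?T * (?w - m) + (ws (Suc t) e - m)"
    by (simp add: field_simps)
  then show ?thesis using True
    by (simp add: deviation_exp_def Let_def fst_omm_state_Suc snd_omm_state_Suc add.commute[of 1]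
        flip: exp_add) (simp add: algebra_simps)
qed (simp add: deviation_exp_def fst_omm_state_Suc snd_omm_state_Suc)

section \<open>The stochastic model: weights, means, histories\<close>

locale matroid_bandit = prob_space M for M :: "'a measure" +
  fixes L K :: nat and \<I> :: "nat set set" and P :: "(nat \<Rightarrow> real) measure"
    and W :: "nat \<Rightarrow> 'a \<Rightarrow> nat \<Rightarrow> real"
  assumes matroid: "matroid L \<I>" and rank: "has_rank \<I> K"
    and indep_weights: "indep_vars (\<lambda>_. weight_space L) W UNIV"
    and distr_weights: "\<And>t. distr M (weight_space L) (W t) = P"
    and weights_bounded: "AE w in P. \<forall>e\<in>{1..L}. 0 \<le> w e \<and> w e \<le> 1"
begin

abbreviation history_space :: "nat \<Rightarrow> (nat \<Rightarrow> nat \<Rightarrow> real) measure" where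
  "history_space t \<equiv> Pi\<^sub>M {..t} (\<lambda>_. weight_space L)"

abbreviation history :: "nat \<Rightarrow> 'a \<Rightarrow> nat \<Rightarrow> nat \<Rightarrow> real" where
  "history t \<omega> \<equiv> restrict (\<lambda>s. W s \<omega>) {..t}"

definition mean_weight :: "nat \<Rightarrow> real" where
  "mean_weight e = (\<integral>w. w e \<partial>P)"

abbreviation counter :: "nat \<Rightarrow> nat \<Rightarrow> 'a \<Rightarrow> nat" where
  "counter t e \<omega> \<equiv> fst (omm_state L \<I> (\<lambda>s. W s \<omega>) t) e"

abbreviation estimate :: "nat \<Rightarrow> nat \<Rightarrow> 'a \<Rightarrow> real" where
  "estimate t e \<omega> \<equiv> snd (omm_state L \<I> (\<lambda>s. W s \<omega>) t) e"

abbreviation action :: "nat \<Rightarrow> 'a \<Rightarrow> nat set" where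
  "action t \<omega> \<equiv> omm_action L \<I> (\<lambda>s. W s \<omega>) t"

lemma W_measurable [measurable]: "W t \<in> M \<rightarrow>\<^sub>M weight_space L"
  using indep_weights by (auto simp: indep_vars_def)

lemma W_component_measurable: "e \<in> {1..L} \<Longrightarrow> (\<lambda>\<omega>. W t \<omega> e) \<in> borel_measurable M"
  using measurable_compose[OF W_measurable weight_space_component] .

lemma AE_W_bounded: "AE \<omega> in M. \<forall>e\<in>{1..L}. 0 \<le> W t \<omega> e \<and> W t \<omega> e \<le> 1"
  using weights_bounded unfolding distr_weights[of t, symmetric] by (rule AE_distrD[OF W_measurable])

lemma expectation_W: "e \<in> {1..L} \<Longrightarrow> expectation (\<lambda>\<omega>. W t \<omega> e) = mean_weight e"
  unfolding mean_weight_def by (subst distr_weights[of t, symmetric], subst integral_distr) auto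

lemma integrable_W: "e \<in> {1..L} \<Longrightarrow> integrable M (\<lambda>\<omega>. W t \<omega> e)"
  by (rule integrable_const_bound[where B = 1, OF _ W_component_measurable])
    (use AE_W_bounded[of t] in \<open>auto elim!: eventually_mono\<close>)

lemma mean_weight_bounds: assumes "e \<in> {1..L}" shows "0 \<le> mean_weight e" "mean_weight e \<le> 1"
proof -
  have "0 \<le> expectation (\<lambda>\<omega>. W 0 \<omega> e)"
    by (rule integral_nonneg_AE) (use AE_W_bounded[of 0] assms in \<open>auto elim!: eventually_mono\<close>)
  moreover have "expectation (\<lambda>\<omega>. W 0 \<omega> e) \<le> expectation (\<lambda>_. 1)"
    by (rule integral_mono_AE[OF integrable_W[OF assms]])
      (use AE_W_bounded[of 0] assms in \<open>auto elim!: eventually_mono\<close>)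
  ultimately show "0 \<le> mean_weight e" "mean_weight e \<le> 1"
    using assms by (auto simp: expectation_W prob_space)
qed

text \<open>The index blocks \<open>{..t}\<close> and \<open>{Suc t}\<close> are disjoint, so the
  corresponding blocks of the independent family are independent. This separates everything known
  before an episode from its weights.\<close>

lemma indep_history:
  assumes f: "f \<in> history_space t \<rightarrow>\<^sub>M N1" and g: "g \<in> weight_space L \<rightarrow>\<^sub>M N2"
  shows "indep_var N1 (\<lambda>\<omega>. f (history t \<omega>)) N2 (\<lambda>\<omega>. g (W (Suc t) \<omega>))"
proof -
  have "indep_var (history_space t) (history t) (Pi\<^sub>M {Suc t} (\<lambda>_. weight_space L))
      (\<lambda>\<omega>. restrict (\<lambda>s. W s \<omega>) {Suc t})"
    by (rule indep_var_restrict[OF indep_weights]) auto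
  from indep_var_compose[OF this f measurable_compose[OF measurable_component_singleton[of "Suc t"] g]]
  show ?thesis by (simp add: comp_def)
qed

lemma omm_state_history: "omm_state L \<I> (history t \<omega>) t = omm_state L \<I> (\<lambda>s. W s \<omega>) t"
  by (rule omm_state_cong) auto

lemma omm_action_history: "omm_action L \<I> (history t \<omega>) (Suc t) = action (Suc t) \<omega>"
  by (rule omm_action_cong) auto

lemma history_component_measurable:
  "s \<le> t \<Longrightarrow> e \<in> {1..L} \<Longrightarrow> (\<lambda>ws. ws s e) \<in> borel_measurable (history_space t)"
  by (rule measurable_compose[OF measurable_component_singleton[of s "{..t}" "\<lambda>_. weight_space L"]
        weight_space_component]) auto

lemma state_history_measurable:
  assumes "e \<in> {1..L}"
  shows "(\<lambda>ws. real (fst (omm_state L \<I> ws t) e)) \<in> borel_measurable (history_space t)"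
    and "(\<lambda>ws. snd (omm_state L \<I> ws t) e) \<in> borel_measurable (history_space t)"
  by (rule borel_measurable_omm_state[OF matroid assms history_component_measurable]; assumption)+

lemma action_history_measurable:
  "{ws \<in> space (history_space t). e \<in> omm_action L \<I> ws (Suc t)} \<in> sets (history_space t)"
  by (rule sets_omm_action_mem_weights[OF matroid history_component_measurable])

lemma counter_measurable [measurable]: "e \<in> {1..L} \<Longrightarrow> (\<lambda>\<omega>. real (counter t e \<omega>)) \<in> borel_measurable M"
  and estimate_measurable [measurable]: "e \<in> {1..L} \<Longrightarrow> estimate t e \<in> borel_measurable M"
  by (rule borel_measurable_omm_state[OF matroid _ W_component_measurable]; assumption)+

lemma action_measurable: "{\<omega> \<in> space M. e \<in> action (Suc t) \<omega>} \<in> sets M"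
  by (rule sets_omm_action_mem_weights[OF matroid W_component_measurable])

end

section \<open>Concentration of the estimates\<close>

context matroid_bandit
begin

abbreviation deviation_process :: "nat \<Rightarrow> real \<Rightarrow> nat \<Rightarrow> 'a \<Rightarrow> real" where
  "deviation_process e l t \<omega> \<equiv> deviation_exp L \<I> e (mean_weight e) l t (\<lambda>s. W s \<omega>)"

lemma deviation_exp_history_measurable:
  assumes "e \<in> {1..L}"
  shows "deviation_exp L \<I> e m l t \<in> borel_measurable (history_space t)"
proof -
  note state_history_measurable[OF assms, measurable]
  show ?thesis unfolding deviation_exp_def[abs_def] Let_def by measurable
qed

lemma deviation_exp_history: "deviation_exp L \<I> e m l t (history t \<omega>) = deviation_exp L \<I> e m l t (\<lambda>s. W s \<omega>)"
  by (simp only: deviation_exp_def omm_state_history)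

text \<open>The supermartingale step, in integrated form and without conditional expectations: on
  histories that choose \<open>e\<close>, the new factor is independent of the past and has mean at
  most 1; on the others the process does not move.\<close>

lemma nn_integral_deviation_process_Suc_le:
  assumes e: "e \<in> {1..L}"
  shows "(\<integral>\<^sup>+\<omega>. ennreal (deviation_process e l (Suc t) \<omega>) \<partial>M)
       \<le> (\<integral>\<^sup>+\<omega>. ennreal (deviation_process e l t \<omega>) \<partial>M)"
proof -
  let ?A = "{ws \<in> space (history_space t). e \<in> omm_action L \<I> ws (Suc t)}"
  let ?Z = "\<lambda>ws. ennreal (deviation_exp L \<I> e (mean_weight e) l t ws)"
  let ?g = "\<lambda>w. ennreal (exp (l * (w e - mean_weight e) - l\<^sup>2 / 8))"
  \<comment> \<open>\<open>F\<close> and \<open>F'\<close> are the parts of the current value on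
    histories that do and do not choose \<open>e\<close> next; only \<open>F\<close> is multiplied
    by the new exponential factor.\<close>
  define F where "F ws = ?Z ws * indicator ?A ws" for ws
  define F' where "F' ws = ?Z ws * indicator (- ?A) ws" for ws
  note deviation_exp_history_measurable[OF e, measurable] action_history_measurable[measurable]
    weight_space_component[OF e, measurable]
  \<comment> \<open>\<open>- ?A\<close> is the complement in the whole type, so measurability is
    stated after intersecting with the space.\<close>
  have A': "- ?A \<inter> space (history_space t) \<in> sets (history_space t)"
    using sets.compl_sets[OF action_history_measurable[of t e]] by (simp add: Diff_eq Int_commute)
  have F [measurable]: "F \<in> borel_measurable (history_space t)"
    unfolding F_def by measurable
  have F' [measurable]: "F' \<in> borel_measurable (history_space t)"
    unfolding F'_def using A' by (intro borel_measurable_times_ennreal borel_measurable_indicator') auto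
  have g [measurable]: "?g \<in> borel_measurable (weight_space L)" by measurable
  have hist [measurable]: "history t \<in> M \<rightarrow>\<^sub>M history_space t"
    by (rule measurable_restrict) simp
  have mem: "history t \<omega> \<in> ?A \<longleftrightarrow> e \<in> action (Suc t) \<omega>" if "\<omega> \<in> space M" for \<omega>
    using measurable_space[OF hist that] by (simp only: mem_Collect_eq omm_action_history) simp
  have step: "ennreal (deviation_process e l (Suc t) \<omega>)
      = F (history t \<omega>) * ?g (W (Suc t) \<omega>) + F' (history t \<omega>)" if "\<omega> \<in> space M" for \<omega>
    using mem[OF that]
    by (cases "e \<in> action (Suc t) \<omega>")
      (simp_all add: F_def F'_def deviation_exp_history deviation_exp_Suc ennreal_mult'' del: restrict_apply)
  have "(\<integral>\<^sup>+\<omega>. ennreal (deviation_process e l (Suc t) \<omega>) \<partial>M)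
      = (\<integral>\<^sup>+\<omega>. F (history t \<omega>) * ?g (W (Suc t) \<omega>) \<partial>M) + (\<integral>\<^sup>+\<omega>. F' (history t \<omega>) \<partial>M)"
    by (subst nn_integral_add[symmetric]) (auto simp: step cong: nn_integral_cong)
  also have "(\<integral>\<^sup>+\<omega>. F (history t \<omega>) * ?g (W (Suc t) \<omega>) \<partial>M)
      = (\<integral>\<^sup>+\<omega>. F (history t \<omega>) \<partial>M) * (\<integral>\<^sup>+\<omega>. ?g (W (Suc t) \<omega>) \<partial>M)"
    by (intro indep_var_nn_integral_mult indep_history F g)
  also have "\<dots> \<le> (\<integral>\<^sup>+\<omega>. F (history t \<omega>) \<partial>M) * 1"
  proof (intro mult_left_mono)
    have "AE \<omega> in M. W (Suc t) \<omega> e \<in> {0..1}"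
      using AE_W_bounded[of "Suc t"] e by (auto elim!: eventually_mono)
    from nn_integral_exp_centered_le_1[OF W_component_measurable[OF e] this, of l]
    show "(\<integral>\<^sup>+\<omega>. ?g (W (Suc t) \<omega>) \<partial>M) \<le> 1" by (simp add: expectation_W[OF e])
  qed simp
  also have "(\<integral>\<^sup>+\<omega>. F (history t \<omega>) \<partial>M) * 1 + (\<integral>\<^sup>+\<omega>. F' (history t \<omega>) \<partial>M)
      = (\<integral>\<^sup>+\<omega>. F (history t \<omega>) + F' (history t \<omega>) \<partial>M)"
    by (subst nn_integral_add) auto
  also have "\<dots> = (\<integral>\<^sup>+\<omega>. ennreal (deviation_process e l t \<omega>) \<partial>M)"
    by (intro nn_integral_cong)
      (auto simp: F_def F'_def deviation_exp_history indicator_def simp del: restrict_apply)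
  finally show ?thesis by (simp add: add_right_mono)
qed

lemma nn_integral_deviation_process_le_1:
  assumes e: "e \<in> {1..L}"
  shows "(\<integral>\<^sup>+\<omega>. ennreal (deviation_process e l t \<omega>) \<partial>M) \<le> 1"
proof (induction t)
  \<comment> \<open>The counter is already 1 at time 0, so the initial value is itself one centred
    exponential factor.\<close>
  case 0
  have "AE \<omega> in M. W 0 \<omega> e \<in> {0..1}"
    using AE_W_bounded[of 0] e by (auto elim!: eventually_mono)
  from nn_integral_exp_centered_le_1[OF W_component_measurable[OF e] this, of l]
  show ?case by (simp add: expectation_W[OF e] deviation_exp_def)
next
  case (Suc t)
  then show ?case using nn_integral_deviation_process_Suc_le[OF e] order_trans by blast
qed

(* Chernoff bound with the exponent 4 * conf t s, which depends on the value s of the counter; hence the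
   counter has to be fixed here, at the price of a union bound later. *)
lemma prob_estimate_deviation_fixed_counter:
  assumes e: "e \<in> {1..L}" and t: "0 < t" and s: "0 < s" and r: "\<bar>r\<bar> = 1"
  shows "prob {\<omega> \<in> space M. counter t e \<omega> = s \<and> conf t s < r * (estimate t e \<omega> - mean_weight e)}
       \<le> 1 / real t ^ 4"
proof -
  let ?c = "conf t s"
  \<comment> \<open>The sign \<open>r\<close> selects the tail, and \<open>4 * ?c\<close> maximizes
    \<open>l * ?c - l^2 / 8\<close> over \<open>l\<close>. Since \<open>s * ?c^2 = 2 * ln t\<close>,
    the exponent is at least \<open>4 * s * ?c^2 - 2 * s * ?c^2 = 4 * ln t\<close> on the
    event.\<close>
  let ?l = "4 * r * ?c"
  let ?E = "{\<omega> \<in> space M. real (counter t e \<omega>) = real s \<and> ?c < r * (estimate t e \<omega> - mean_weight e)}"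
  note counter_measurable[OF e, measurable] estimate_measurable[OF e, measurable]
  have E: "?E \<in> sets M" by measurable
  have r2: "r\<^sup>2 = 1" using r by (metis one_power2 power2_abs)
  have c2: "real s * ?c\<^sup>2 = 2 * ln (real t)"
    using t s by (simp add: conf_def)
  have t4: "exp (4 * ln (real t)) = real t ^ 4"
    using t exp_of_nat_mult[of 4 "ln (real t)"] by simp
  have "real t ^ 4 \<le> deviation_process e ?l t \<omega>" if "\<omega> \<in> ?E" for \<omega>
  proof -
    let ?x = "r * (estimate t e \<omega> - mean_weight e)"
    have "?c * ?c \<le> ?c * ?x" using that conf_nonneg[of t s] by (intro mult_left_mono) auto
    then have "4 * (real s * (?c * ?c)) \<le> 4 * (real s * (?c * ?x))" by (simp add: mult_left_mono)
    moreover have "?l * (real s * (estimate t e \<omega> - mean_weight e)) - ?l\<^sup>2 / 8 * real s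
        = 4 * (real s * (?c * ?x)) - 2 * (real s * ?c\<^sup>2)"
      by (simp add: power_mult_distrib r2 algebra_simps)
    ultimately have "4 * ln (real t)
        \<le> ?l * (real s * (estimate t e \<omega> - mean_weight e)) - ?l\<^sup>2 / 8 * real s"
      using c2 c2[unfolded power2_eq_square] by linarith
    then have "exp (4 * ln (real t)) \<le> deviation_process e ?l t \<omega>"
      using that by (simp add: deviation_exp_def Let_def)
    then show ?thesis by (simp only: t4)
  qed
  then have "(\<integral>\<^sup>+\<omega>. ennreal (real t ^ 4) * indicator ?E \<omega> \<partial>M)
      \<le> (\<integral>\<^sup>+\<omega>. ennreal (deviation_process e ?l t \<omega>) \<partial>M)"
    by (intro nn_integral_mono) (auto simp: indicator_def intro!: ennreal_leI)
  also have "\<dots> \<le> 1" by (rule nn_integral_deviation_process_le_1[OF e])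
  finally have "ennreal (real t ^ 4 * prob ?E) \<le> 1"
    using E by (simp add: nn_integral_cmult_indicator emeasure_eq_measure ennreal_mult)
  then have "real t ^ 4 * prob ?E \<le> 1" by (simp flip: ennreal_1)
  then show ?thesis using t by (simp add: field_simps)
qed

definition bad_event :: "nat \<Rightarrow> 'a set" where
  "bad_event t = {\<omega> \<in> space M. \<exists>e\<in>{1..L}. conf t (counter t e \<omega>) < \<bar>estimate t e \<omega> - mean_weight e\<bar>}"

lemma sets_bad_event [measurable]: "bad_event t \<in> sets M"
  unfolding bad_event_def
proof (intro sets.sets_Collect_finite_Ex)
  fix e assume e: "e \<in> {1..L}"
  note counter_measurable[OF e, measurable] estimate_measurable[OF e, measurable]
  show "{\<omega> \<in> space M. conf t (counter t e \<omega>) < \<bar>estimate t e \<omega> - mean_weight e\<bar>} \<in> sets M"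
    unfolding conf_def by measurable
qed simp

lemma prob_bad_event_le:
  assumes t: "0 < t"
  shows "prob (bad_event t) \<le> 4 * real L / real t ^ 2"
proof -
  \<comment> \<open>The union bound runs over the item, the possible counter values after
    \<open>t\<close> episodes and the sign of the deviation: \<open>2 * L * (t + 1)\<close> events
    of probability at most \<open>1 / t^4\<close> each.\<close>
  let ?D = "{1..L} \<times> {1..t+1} \<times> {1, -1 :: real}"
  define B where "B = (\<lambda>(e, s, r). {\<omega> \<in> space M. counter t e \<omega> = s \<and>
      conf t s < r * (estimate t e \<omega> - mean_weight e)})"
  have meas: "B d \<in> sets M" if dD: "d \<in> ?D" for d
  proof -
    obtain e s r where d: "d = (e, s, r)" "e \<in> {1..L}" using dD by (cases d) auto
    note counter_measurable[OF d(2), measurable] estimate_measurable[OF d(2), measurable]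
    have "{\<omega> \<in> space M. real (counter t e \<omega>) = real s \<and> conf t s < r * (estimate t e \<omega> - mean_weight e)} \<in> sets M"
      by measurable
    then show ?thesis by (simp add: B_def d(1))
  qed
  have "bad_event t \<subseteq> (\<Union>d\<in>?D. B d)"
  proof
    fix \<omega> assume "\<omega> \<in> bad_event t"
    then obtain e where e: "e \<in> {1..L}" "\<omega> \<in> space M"
      "conf t (counter t e \<omega>) < \<bar>estimate t e \<omega> - mean_weight e\<bar>"
      by (auto simp: bad_event_def)
    define r :: real where "r = (if estimate t e \<omega> - mean_weight e < 0 then -1 else 1)"
    have "(e, counter t e \<omega>, r) \<in> ?D"
      using e(1) omm_state_counter_bounds[of L \<I> "\<lambda>s. W s \<omega>" t e] by (auto simp: r_def)
    moreover have "\<omega> \<in> B (e, counter t e \<omega>, r)" using e by (auto simp: B_def r_def)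
    ultimately show "\<omega> \<in> (\<Union>d\<in>?D. B d)" by blast
  qed
  then have "prob (bad_event t) \<le> prob (\<Union>d\<in>?D. B d)"
    by (intro finite_measure_mono sets.finite_UN meas) auto
  also have "\<dots> \<le> (\<Sum>d\<in>?D. prob (B d))"
    by (intro finite_measure_subadditive_finite) (use meas in auto)
  also have "\<dots> \<le> (\<Sum>d\<in>?D. 1 / real t ^ 4)"
    by (intro sum_mono) (auto simp: B_def intro!: prob_estimate_deviation_fixed_counter t)
  also have "\<dots> = 2 * real L * (real t + 1) / real t ^ 4"
    by (simp add: card_cartesian_product) (simp add: algebra_simps)
  also have "\<dots> \<le> 2 * real L * (2 * real t ^ 2) / real t ^ 4"
  proof (intro divide_right_mono mult_left_mono)
    have "real t * 1 \<le> real t * real t" using t by (intro mult_left_mono) auto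
    then show "real t + 1 \<le> 2 * real t ^ 2" using t unfolding power2_eq_square by linarith
  qed auto
  also have "\<dots> = 4 * real L / real t ^ 2"
    using t by (simp add: field_simps power2_eq_square power4_eq_xxxx)
  finally show ?thesis .
qed

lemma sum_prob_bad_event_le: "(\<Sum>t\<in>{1..n}. prob (bad_event (t - 1))) \<le> 1 + 2 / 3 * pi\<^sup>2 * real L"
proof (cases n)
  case (Suc m)
  have "(\<Sum>t\<in>{1..n}. prob (bad_event (t - 1))) = (\<Sum>t<Suc m. prob (bad_event t))"
    unfolding Suc by (rule sum.reindex_bij_witness[of _ Suc "\<lambda>t. t - 1"]) auto
  also have "\<dots> = prob (bad_event 0) + (\<Sum>t<m. prob (bad_event (Suc t)))"
    by (rule sum.lessThan_Suc_shift)
  \<comment> \<open>At time 0 the radius is 0, so the probability is bounded trivially by 1. The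
    other terms form a Basel sum, giving \<open>4 * L * pi^2 / 6\<close>.\<close>
  also have "\<dots> \<le> 1 + (\<Sum>t<m. 4 * real L * (1 / (real t + 1)\<^sup>2))"
    using prob_bad_event_le[of "Suc _"] by (intro add_mono sum_mono) (auto simp: add.commute)
  also have "(\<Sum>t<m. 4 * real L * (1 / (real t + 1)\<^sup>2)) = 4 * real L * (\<Sum>t<m. 1 / (real t + 1)\<^sup>2)"
    by (simp only: sum_distrib_left)
  also have "\<dots> \<le> 4 * real L * (pi\<^sup>2 / 6)"
  proof (intro mult_left_mono)
    have "(\<Sum>t<m. 1 / (real t + 1)\<^sup>2) \<le> (\<Sum>t. 1 / (real t + 1)\<^sup>2)"
      using inverse_squares_sums by (intro sum_le_suminf) (auto simp: sums_iff add.commute)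
    also have "\<dots> = pi\<^sup>2 / 6"
      using inverse_squares_sums by (simp add: sums_iff add.commute)
    finally show "(\<Sum>t<m. 1 / (real t + 1)\<^sup>2) \<le> pi\<^sup>2 / 6" .
  qed simp
  finally show ?thesis by (simp add: algebra_simps)
qed simp

section \<open>From pointwise gaps to expected regret\<close>

lemma action_subset: "action t \<omega> \<subseteq> {1..L}"
  unfolding omm_action_def by (rule omm_greedy_subset[OF matroid])

text \<open>Off the bad event each index lies between the mean and the mean plus two radii. Hence
  passing from means to indices can only raise the value of \<open>B\<close>, the greedy basis is at
  least as good for the indices, and returning to means costs two radii per chosen item. The action
  of episode \<open>Suc t\<close> uses counters and radii of time \<open>t\<close>.\<close>

lemma regret_le:
  assumes B: "is_basis \<I> B" and \<omega>: "\<omega> \<in> space M"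
  shows "fval B mean_weight - fval (action (Suc t) \<omega>) mean_weight
       \<le> (\<Sum>e\<in>action (Suc t) \<omega>. 2 * conf t (counter t e \<omega>)) + real K * indicator (bad_event t) \<omega>"
proof -
  let ?A = "action (Suc t) \<omega>"
  let ?U = "omm_ucb (Suc t) (omm_state L \<I> (\<lambda>s. W s \<omega>) t)"
  have BL: "B \<subseteq> {1..L}" "card B = K"
    using B matroid rank unfolding is_basis_def matroid_def has_rank_def by auto
  show ?thesis
  proof (cases "\<omega> \<in> bad_event t")
    case True
    have "fval B mean_weight \<le> real (card B) * 1"
      unfolding fval_def by (rule sum_bounded_above) (use BL mean_weight_bounds in auto)
    moreover have "0 \<le> fval ?A mean_weight"
      unfolding fval_def by (rule sum_nonneg) (use action_subset mean_weight_bounds in blast)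
    moreover have "0 \<le> (\<Sum>e\<in>?A. 2 * conf t (counter t e \<omega>))"
      by (intro sum_nonneg) (simp add: conf_nonneg)
    ultimately show ?thesis using True BL by simp
  next
    case False
    then have dev: "\<bar>estimate t e \<omega> - mean_weight e\<bar> \<le> conf t (counter t e \<omega>)" if "e \<in> {1..L}" for e
      using that \<omega> by (auto simp: bad_event_def not_less)
    have "fval B mean_weight \<le> fval B ?U"
      unfolding fval_def
    proof (rule sum_mono)
      fix e assume "e \<in> B"
      then have "e \<in> {1..L}" using BL by blast
      from dev[OF this] show "mean_weight e \<le> ?U e" by (simp add: omm_ucb_def)
    qed
    also have "\<dots> \<le> fval ?A ?U"
      using omm_greedy_optimal[OF matroid rank B, of ?U] by (simp add: omm_action_def)
    also have "\<dots> \<le> (\<Sum>e\<in>?A. mean_weight e + 2 * conf t (counter t e \<omega>))"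
      unfolding fval_def
    proof (rule sum_mono)
      fix e assume "e \<in> ?A"
      then have "e \<in> {1..L}" using action_subset by blast
      from dev[OF this] show "?U e \<le> mean_weight e + 2 * conf t (counter t e \<omega>)"
        by (simp add: omm_ucb_def)
    qed
    finally show ?thesis using False by (simp add: fval_def sum.distrib)
  qed
qed

lemma integrable_action_indicator: "integrable M (indicat_real {\<omega>\<in>space M. e \<in> action (Suc t) \<omega>})"
  by (rule integrable_real_indicator[OF action_measurable]) (simp add: emeasure_eq_measure)

text \<open>Whether \<open>e\<close> is chosen is a function of the history, hence independent of
  the weight of \<open>e\<close> in the same episode. The indicator is therefore rewritten as a
  function on the history space before the product rule is used.\<close>

lemma expectation_action_reward:
  assumes "e \<in> {1..L}"
  shows "integrable M (\<lambda>\<omega>. indicat_real {\<omega>\<in>space M. e \<in> action (Suc t) \<omega>} \<omega> * W (Suc t) \<omega> e)"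
    and "expectation (\<lambda>\<omega>. indicat_real {\<omega>\<in>space M. e \<in> action (Suc t) \<omega>} \<omega> * W (Suc t) \<omega> e)
       = expectation (indicat_real {\<omega>\<in>space M. e \<in> action (Suc t) \<omega>}) * mean_weight e"
proof -
  let ?A = "{\<omega>\<in>space M. e \<in> action (Suc t) \<omega>}"
  let ?H = "{ws \<in> space (history_space t). e \<in> omm_action L \<I> ws (Suc t)}"
  have hist: "history t \<in> M \<rightarrow>\<^sub>M history_space t"
    by (rule measurable_restrict) simp
  have eq: "indicat_real ?H (history t \<omega>) = indicat_real ?A \<omega>" if "\<omega> \<in> space M" for \<omega>
    using measurable_space[OF hist that] that
    by (simp only: indicator_def mem_Collect_eq omm_action_history simp_thms)
  have ind: "indep_var borel (\<lambda>\<omega>. indicat_real ?H (history t \<omega>)) borel (\<lambda>\<omega>. W (Suc t) \<omega> e)"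
    by (intro indep_history borel_measurable_indicator action_history_measurable weight_space_component assms)
  have int: "integrable M (\<lambda>\<omega>. indicat_real ?H (history t \<omega>))"
    by (rule iffD2[OF Bochner_Integration.integrable_cong[OF refl eq]], assumption) (rule integrable_action_indicator)
  note int_W = integrable_W[OF assms, of "Suc t"]
  have eq': "indicat_real ?H (history t \<omega>) * W (Suc t) \<omega> e = indicat_real ?A \<omega> * W (Suc t) \<omega> e"
    if "\<omega> \<in> space M" for \<omega>
    by (simp only: eq[OF that])
  show "integrable M (\<lambda>\<omega>. indicat_real ?A \<omega> * W (Suc t) \<omega> e)"
    by (rule iffD1[OF Bochner_Integration.integrable_cong[OF refl eq']], assumption)
      (rule indep_var_integrable[OF ind int int_W])
  have "expectation (\<lambda>\<omega>. indicat_real ?A \<omega> * W (Suc t) \<omega> e)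
      = expectation (\<lambda>\<omega>. indicat_real ?H (history t \<omega>) * W (Suc t) \<omega> e)"
    by (rule Bochner_Integration.integral_cong[OF refl eq'[symmetric]])
  also have "\<dots> = expectation (\<lambda>\<omega>. indicat_real ?H (history t \<omega>)) * mean_weight e"
    by (simp only: indep_var_lebesgue_integral[OF ind int int_W] expectation_W[OF assms])
  also have "expectation (\<lambda>\<omega>. indicat_real ?H (history t \<omega>)) = expectation (indicat_real ?A)"
    by (rule Bochner_Integration.integral_cong[OF refl eq])
  finally show "expectation (\<lambda>\<omega>. indicat_real ?A \<omega> * W (Suc t) \<omega> e)
       = expectation (indicat_real ?A) * mean_weight e" .
qed

text \<open>A sum over a random set becomes a sum over a fixed set with random indicators, to which
  linearity of the integral applies.\<close>

lemma fval_action: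
  assumes "\<omega> \<in> space M"
  shows "fval (action t \<omega>) w = (\<Sum>e\<in>{1..L}. indicat_real {\<omega>\<in>space M. e \<in> action t \<omega>} \<omega> * w e)"
  unfolding fval_def using action_subset[of \<omega> t] assms
  by (intro sum.mono_neutral_cong_left) (auto simp: indicator_def)

lemma integrable_fval_action: "integrable M (\<lambda>\<omega>. fval (action (Suc t) \<omega>) (W (Suc t) \<omega>))"
  by (rule iffD2[OF Bochner_Integration.integrable_cong[OF refl fval_action]], assumption)
    (intro Bochner_Integration.integrable_sum expectation_action_reward)

lemma integrable_fval_action_mean: "integrable M (\<lambda>\<omega>. fval (action (Suc t) \<omega>) mean_weight)"
  by (rule iffD2[OF Bochner_Integration.integrable_cong[OF refl fval_action]], assumption)
    (intro Bochner_Integration.integrable_sum integrable_mult_left integrable_action_indicator)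

lemma expectation_fval_action:
  "expectation (\<lambda>\<omega>. fval (action (Suc t) \<omega>) (W (Suc t) \<omega>)) = expectation (\<lambda>\<omega>. fval (action (Suc t) \<omega>) mean_weight)"
proof -
  let ?I = "\<lambda>e. indicat_real {\<omega>\<in>space M. e \<in> action (Suc t) \<omega>}"
  have "expectation (\<lambda>\<omega>. fval (action (Suc t) \<omega>) (W (Suc t) \<omega>))
      = expectation (\<lambda>\<omega>. \<Sum>e\<in>{1..L}. ?I e \<omega> * W (Suc t) \<omega> e)"
    by (intro Bochner_Integration.integral_cong refl fval_action)
  also have "\<dots> = (\<Sum>e\<in>{1..L}. expectation (\<lambda>\<omega>. ?I e \<omega> * W (Suc t) \<omega> e))"
    by (intro Bochner_Integration.integral_sum expectation_action_reward)
  also have "\<dots> = (\<Sum>e\<in>{1..L}. expectation (\<lambda>\<omega>. ?I e \<omega> * mean_weight e))"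
    using expectation_action_reward(2) by (intro sum.cong) auto
  also have "\<dots> = expectation (\<lambda>\<omega>. \<Sum>e\<in>{1..L}. ?I e \<omega> * mean_weight e)"
    by (intro Bochner_Integration.integral_sum[symmetric] integrable_mult_left integrable_action_indicator)
  also have "\<dots> = expectation (\<lambda>\<omega>. fval (action (Suc t) \<omega>) mean_weight)"
    by (intro Bochner_Integration.integral_cong refl fval_action[symmetric])
  finally show ?thesis .
qed

lemma expected_regret_le:
  assumes B: "is_basis \<I> B"
  shows "integrable M (\<lambda>\<omega>. \<Sum>t\<in>{1..n}. fval B (W t \<omega>) - fval (action t \<omega>) (W t \<omega>))"
    and "expectation (\<lambda>\<omega>. \<Sum>t\<in>{1..n}. fval B (W t \<omega>) - fval (action t \<omega>) (W t \<omega>))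
       \<le> 8 * sqrt (real K * real L * real n * ln (real n)) + 4 / 3 * pi ^ 2 * real K * real L"
proof -
  have BL: "B \<subseteq> {1..L}" "card B = K"
    using B matroid rank unfolding is_basis_def matroid_def has_rank_def by auto
  have int_B: "integrable M (\<lambda>\<omega>. fval B (W t \<omega>))" for t
    unfolding fval_def using BL by (intro Bochner_Integration.integrable_sum integrable_W) auto
  have exp_B: "expectation (\<lambda>\<omega>. fval B (W t \<omega>)) = fval B mean_weight" for t
    unfolding fval_def using BL
    by (subst Bochner_Integration.integral_sum) (auto intro!: integrable_W sum.cong expectation_W)
  have int_A: "integrable M (\<lambda>\<omega>. fval (action t \<omega>) (W t \<omega>))"
    and int_A_mean: "integrable M (\<lambda>\<omega>. fval (action t \<omega>) mean_weight)"
    and exp_A: "expectation (\<lambda>\<omega>. fval (action t \<omega>) (W t \<omega>))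
      = expectation (\<lambda>\<omega>. fval (action t \<omega>) mean_weight)" if "t \<in> {1..n}" for t
    using that integrable_fval_action[of "t - 1"] integrable_fval_action_mean[of "t - 1"]
      expectation_fval_action[of "t - 1"] by auto
  show "integrable M (\<lambda>\<omega>. \<Sum>t\<in>{1..n}. fval B (W t \<omega>) - fval (action t \<omega>) (W t \<omega>))"
    by (intro Bochner_Integration.integrable_sum Bochner_Integration.integrable_diff int_A int_B)
  have int_bad: "integrable M (indicat_real (bad_event t))" for t
    by (rule integrable_real_indicator[OF sets_bad_event]) (simp add: emeasure_eq_measure)
  have int_bad_sum: "integrable M (\<lambda>\<omega>. \<Sum>t\<in>{1..n}. indicat_real (bad_event (t - 1)) \<omega>)"
    by (rule Bochner_Integration.integrable_sum) (rule int_bad)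
  have exp_bad: "expectation (\<lambda>\<omega>. \<Sum>t\<in>{1..n}. indicat_real (bad_event (t - 1)) \<omega>)
      = (\<Sum>t\<in>{1..n}. prob (bad_event (t - 1)))"
    by (subst Bochner_Integration.integral_sum[OF int_bad]) (simp add: sets.Int_space_eq2)
  let ?R = "8 * sqrt (real K * real L * real n * ln (real n))"
  have int_D: "integrable M (\<lambda>\<omega>. \<Sum>t\<in>{1..n}. fval B mean_weight - fval (action t \<omega>) mean_weight)"
    by (rule Bochner_Integration.integrable_sum, rule Bochner_Integration.integrable_diff,
        rule integrable_const, rule int_A_mean)
  have int_bound: "integrable M (\<lambda>\<omega>. ?R + real K * (\<Sum>t\<in>{1..n}. indicat_real (bad_event (t - 1)) \<omega>))"
    by (rule Bochner_Integration.integrable_add, rule integrable_const, rule integrable_mult_right,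
        rule int_bad_sum)
  \<comment> \<open>Observed weights are replaced by means: for \<open>B\<close> by linearity, for
    the action by its independence from the current weights.\<close>
  have "expectation (\<lambda>\<omega>. \<Sum>t\<in>{1..n}. fval B (W t \<omega>) - fval (action t \<omega>) (W t \<omega>))
      = (\<Sum>t\<in>{1..n}. expectation (\<lambda>\<omega>. fval B mean_weight - fval (action t \<omega>) mean_weight))"
    by (subst Bochner_Integration.integral_sum)
      (auto simp: int_A int_B int_A_mean exp_A exp_B prob_space intro!: sum.cong)
  also have "\<dots> = expectation (\<lambda>\<omega>. \<Sum>t\<in>{1..n}. fval B mean_weight - fval (action t \<omega>) mean_weight)"
    by (intro Bochner_Integration.integral_sum[symmetric] Bochner_Integration.integrable_diff int_A_mean) auto
  also have "\<dots> \<le> expectation (\<lambda>\<omega>. ?R + real K * (\<Sum>t\<in>{1..n}. indicat_real (bad_event (t - 1)) \<omega>))"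
  proof (rule integral_mono)
    fix \<omega> assume \<omega>: "\<omega> \<in> space M"
    have "(\<Sum>t\<in>{1..n}. fval B mean_weight - fval (action t \<omega>) mean_weight)
        \<le> (\<Sum>t\<in>{1..n}. (\<Sum>e\<in>action t \<omega>. 2 * conf (t - 1) (counter (t - 1) e \<omega>))
              + real K * indicat_real (bad_event (t - 1)) \<omega>)"
    proof (rule sum_mono)
      fix t assume "t \<in> {1..n}"
      then show "fval B mean_weight - fval (action t \<omega>) mean_weight
          \<le> (\<Sum>e\<in>action t \<omega>. 2 * conf (t - 1) (counter (t - 1) e \<omega>))
              + real K * indicat_real (bad_event (t - 1)) \<omega>"
        using regret_le[OF B \<omega>, of "t - 1"] by simp
    qed
    \<comment> \<open>The radii are bounded by \<open>?R\<close> for every weight sequence, so only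
      the bad events are left to the expectation.\<close>
    also have "\<dots> \<le> ?R + real K * (\<Sum>t\<in>{1..n}. indicat_real (bad_event (t - 1)) \<omega>)"
      using sum_conf_le[OF matroid rank, where ws = "\<lambda>s. W s \<omega>" and n = n]
      by (simp only: sum.distrib sum_distrib_left add_right_mono)
    finally show "(\<Sum>t\<in>{1..n}. fval B mean_weight - fval (action t \<omega>) mean_weight)
        \<le> ?R + real K * (\<Sum>t\<in>{1..n}. indicat_real (bad_event (t - 1)) \<omega>)" .
  qed (rule int_D int_bound)+
  also have "\<dots> = ?R + real K * (\<Sum>t\<in>{1..n}. prob (bad_event (t - 1)))"
    by (subst Bochner_Integration.integral_add)
      (auto simp: prob_space exp_bad simp del: One_nat_def intro!: integrable_mult_right int_bad_sum)
  also have "\<dots> \<le> ?R + real K * (1 + 2 / 3 * pi\<^sup>2 * real L)"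
    by (intro add_left_mono mult_left_mono sum_prob_bad_event_le) auto
  \<comment> \<open>The extra \<open>K\<close> from the first episode is absorbed by a second copy
    of the series term: \<open>2 / 3 * pi^2 * L >= 1\<close> because \<open>pi > 3\<close> and, for
    positive \<open>K\<close>, the basis \<open>B\<close> forces \<open>L >= 1\<close>.\<close>
  also have "real K * (1 + 2 / 3 * pi\<^sup>2 * real L) \<le> real K * (2 / 3 * pi\<^sup>2 * real L + 2 / 3 * pi\<^sup>2 * real L)"
  proof (cases "K = 0")
    case False
    then have "1 \<le> L" using BL by (cases L) auto
    moreover have "3\<^sup>2 \<le> pi\<^sup>2" using pi_gt3 by (intro power_mono) auto
    ultimately have "1 * 1 \<le> 2 / 3 * pi\<^sup>2 * real L" by (intro mult_mono) auto
    then show ?thesis by (intro mult_left_mono add_right_mono) auto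
  qed simp
  finally show "expectation (\<lambda>\<omega>. \<Sum>t\<in>{1..n}. fval B (W t \<omega>) - fval (action t \<omega>) (W t \<omega>))
       \<le> 8 * sqrt (real K * real L * real n * ln (real n)) + 4 / 3 * pi ^ 2 * real K * real L"
    by (simp add: algebra_simps)
qed

end

theorem theorem3:
  fixes L K n :: nat
    and \<I> :: "nat set set"
    and P :: "(nat \<Rightarrow> real) measure"
    and M :: "'a measure"
    and W :: "nat \<Rightarrow> 'a \<Rightarrow> (nat \<Rightarrow> real)"
    and Astar :: "nat set"
  assumes "matroid L \<I>"
    and "has_rank \<I> K"
    and "prob_space M"
    and "prob_space.indep_vars M (\<lambda>_. weight_space L) W UNIV"
    and "\<And>t. distr M (weight_space L) (W t) = P"
    and "AE w in P. \<forall>e\<in>{1..L}. 0 \<le> w e \<and> w e \<le> 1"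
    and "is_basis \<I> Astar"
    and "\<forall>A\<in>\<I>. fval A (\<lambda>e. \<integral>w. w e \<partial>P) \<le> fval Astar (\<lambda>e. \<integral>w. w e \<partial>P)"
  shows "integrable M (\<lambda>\<omega>. \<Sum>t\<in>{1..n}.
             fval Astar (W t \<omega>) - fval (omm_action L \<I> (\<lambda>s. W s \<omega>) t) (W t \<omega>))
       \<and> (\<integral>\<omega>. (\<Sum>t\<in>{1..n}.
             fval Astar (W t \<omega>) - fval (omm_action L \<I> (\<lambda>s. W s \<omega>) t) (W t \<omega>)) \<partial>M)
         \<le> 8 * sqrt (real K * real L * real n * ln (real n)) + 4 / 3 * pi ^ 2 * real K * real L"
proof -
  interpret matroid_bandit M L K \<I> P W
    by (rule matroid_bandit.intro[OF assms(3)]) (unfold_locales, use assms in auto)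
  show ?thesis using expected_regret_le[OF assms(7), of n] by blast
qed

end
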